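(* Let $G_0=P_{n_1}\,\Box\,P_{n_2}$ be a grid of dimension $n_1\times n_2$. Let $\lambda=\lambda_{1,1}+\lambda_{1,2}=\lambda_{2,1}+\lambda_{2,2}$ be a Laplacian eigenvalue of $G_0$ of multiplicity two, with $\lambda_{1,1}$ and $\lambda_{2,1}$ Laplacian eigenvalues of $P_{n_1}$, $\lambda_{1,2}$ and $\lambda_{2,2}$ Laplacian eigenvalues of $P_{n_2}$, and $(\lambda_{1,1},\lambda_{1,2})\ne(\lambda_{2,1},\lambda_{2,2})$. Let $V_\lambda$ be the associated eigenspace. Then there exists an eigenvector $v\in V_\lambda$ with zero components $[\nu_1,\ell_1]$ and $[\nu_2,\ell_2]$, $\nu_1,\nu_2\in\{1,\dots,n_1\}$, $\ell_1,\ell_2\in\{1,\dots,n_2\}$, if and only if $$p_{\nu_1}(\lambda_{1,1})\,p_{\ell_1}(\lambda_{1,2})\,p_{\nu_2}(\lambda_{2,1})\,p_{\ell_2}(\lambda_{2,2})=p_{\nu_1}(\lambda_{2,1})\,p_{\ell_1}(\lambda_{2,2})\,p_{\nu_2}(\lambda_{1,1})\,p_{\ell_2}(\lambda_{1,2}),$$ where $p_r(s)$ is the polynomial of degree $r-1$ defined by $p_1(s)=1$, $p_2(s)=1-s$ and $p_r(s)=(2-s)p_{r-1}(s)-p_{r-2}(s)$ for $r\ge 3$.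
   Context: The path graph $P_n$ of length $n$ has node set $\{1,\dots,n\}$ and edges $(i,i+1)$, $1\le i\le n-1$. The Laplacian of a graph is $L=D-A$. $P_{n_1}\Box P_{n_2}$ denotes the Cartesian product; its nodes are $[\nu,\ell]$, $\nu\in\{1,\dots,n_1\}$, $\ell\in\{1,\dots,n_2\}$, and vectors in $\mathbb R^{n_1n_2}$ are indexed lexicographically by nodes, so $(x\otimes y)_{[\nu,\ell]}=(x)_\nu(y)_\ell$. Eigenvectors are nonzero by definition. *)

theory Defs
  imports
    "Graph_Theory.Pair_Digraph"
    "Jordan_Normal_Form.Char_Poly"
    "Jordan_Normal_Form.Matrix_Kernel"
begin

text \<open>
  A finite simple graph is a \<^locale>\<open>pair_graph\<close>: a finite, symmetric, loop-free digraph
  without parallel arcs, so that the undirected edge between u and v is the pair of arcs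
  (u,v) and (v,u), and the degree of a node is its out-degree.
\<close>

definition path_graph :: "nat \<Rightarrow> nat pair_pre_digraph" where
  "path_graph n = \<lparr> pverts = {1..n},
     parcs = {(i, j). i \<in> {1..n} \<and> j \<in> {1..n} \<and> (j = i + 1 \<or> i = j + 1)} \<rparr>"

definition cart_prod ::
  "'a pair_pre_digraph \<Rightarrow> 'b pair_pre_digraph \<Rightarrow> ('a \<times> 'b) pair_pre_digraph" where
  "cart_prod G H = \<lparr> pverts = pverts G \<times> pverts H,
     parcs = {((u, x), (v, y)) | u x v y.
                (u = v \<and> u \<in> pverts G \<and> (x, y) \<in> parcs H) \<or>
                (x = y \<and> x \<in> pverts H \<and> (u, v) \<in> parcs G)} \<rparr>"

lemma pair_graph_path_graph: "pair_graph (path_graph n)"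
proof -
  have "finite (parcs (path_graph n))"
    by (rule finite_subset[of _ "{1..n} \<times> {1..n}"]) (auto simp: path_graph_def)
  then show ?thesis
    by unfold_locales
      (auto simp: path_graph_def symmetric_def sym_def)
qed

lemma pair_graph_cart_prod:
  assumes "pair_graph G" and "pair_graph H"
  shows "pair_graph (cart_prod G H)"
proof -
  interpret G: pair_graph G by fact
  interpret H: pair_graph H by fact
  have "parcs (cart_prod G H) \<subseteq> (pverts G \<times> pverts H) \<times> (pverts G \<times> pverts H)"
    by (auto simp: cart_prod_def dest: G.in_arcsD1 G.in_arcsD2 H.in_arcsD1 H.in_arcsD2)
  then have "finite (parcs (cart_prod G H))"
    by (rule finite_subset) (simp add: G.pair_finite_verts H.pair_finite_verts)
  moreover have "sym (parcs G)" "sym (parcs H)"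
    using G.pair_sym_arcs H.pair_sym_arcs by (simp_all add: symmetric_def)
  ultimately show ?thesis
    by unfold_locales
      (auto simp: cart_prod_def symmetric_def sym_def G.pair_finite_verts H.pair_finite_verts
        dest: G.in_arcsD1 G.in_arcsD2 H.in_arcsD1 H.in_arcsD2 G.pair_no_loops H.pair_no_loops)
qed

text \<open>
  The list \<open>vs\<close> enumerates the nodes of the graph without repetition and thereby fixes the
  order of the rows and columns.
\<close>

definition degree_mat :: "'a pair_pre_digraph \<Rightarrow> 'a list \<Rightarrow> real mat" where
  "degree_mat G vs = mat (length vs) (length vs)
     (\<lambda>(i, j). if i = j then real (out_degree (with_proj G) (vs ! i)) else 0)"

definition adjacency_mat :: "'a pair_pre_digraph \<Rightarrow> 'a list \<Rightarrow> real mat" where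
  "adjacency_mat G vs = mat (length vs) (length vs)
     (\<lambda>(i, j). if (vs ! i, vs ! j) \<in> parcs G then 1 else 0)"

definition laplacian_mat :: "'a pair_pre_digraph \<Rightarrow> 'a list \<Rightarrow> real mat" where
  "laplacian_mat G vs = degree_mat G vs - adjacency_mat G vs"

definition path_nodes :: "nat \<Rightarrow> nat list" where
  "path_nodes n = [1..<Suc n]"

definition path_laplacian :: "nat \<Rightarrow> real mat" where
  "path_laplacian n = laplacian_mat (path_graph n) (path_nodes n)"

text \<open>\<^const>\<open>List.product\<close> lists the pairs in lexicographic order.\<close>

definition grid_laplacian :: "nat \<Rightarrow> nat \<Rightarrow> real mat" where
  "grid_laplacian n1 n2 = laplacian_mat (cart_prod (path_graph n1) (path_graph n2))
     (List.product (path_nodes n1) (path_nodes n2))"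

text \<open>Zero-based position of the node (nu, l) in the lexicographic enumeration.\<close>

definition grid_index :: "nat \<Rightarrow> nat \<Rightarrow> nat \<Rightarrow> nat" where
  "grid_index n2 nu l = (nu - 1) * n2 + (l - 1)"

lemma length_path_nodes: "length (path_nodes n) = n"
  by (simp add: path_nodes_def)

lemma path_nodes: "distinct (path_nodes n)" "set (path_nodes n) = pverts (path_graph n)"
  by (auto simp: path_nodes_def path_graph_def)

lemma grid_nodes:
  "distinct (List.product (path_nodes n1) (path_nodes n2))"
  "set (List.product (path_nodes n1) (path_nodes n2)) =
     pverts (cart_prod (path_graph n1) (path_graph n2))"
  by (simp_all add: distinct_product path_nodes cart_prod_def)

lemma grid_index:
  assumes "nu \<in> {1..n1}" and "l \<in> {1..n2}"
  shows "grid_index n2 nu l < n1 * n2"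
    and "List.product (path_nodes n1) (path_nodes n2) ! grid_index n2 nu l = (nu, l)"
proof -
  have "grid_index n2 nu l < (nu - 1) * n2 + n2"
    using assms by (auto simp: grid_index_def)
  also have "\<dots> = nu * n2"
    using assms by (cases nu) auto
  also have "\<dots> \<le> n1 * n2"
    using assms by simp
  finally show less: "grid_index n2 nu l < n1 * n2" .
  have "0 < n2" "l - 1 < n2"
    using assms by auto
  then have "grid_index n2 nu l div n2 = nu - 1" "grid_index n2 nu l mod n2 = l - 1"
    by (simp_all add: grid_index_def del: One_nat_def)
  moreover have "path_nodes n1 ! (nu - 1) = nu" "path_nodes n2 ! (l - 1) = l"
    using assms by (auto simp: path_nodes_def simp del: upt_Suc)
  ultimately show "List.product (path_nodes n1) (path_nodes n2) ! grid_index n2 nu l = (nu, l)"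
    using less by (simp add: product_nth length_path_nodes)
qed

definition eigenspace :: "'a :: field mat \<Rightarrow> 'a \<Rightarrow> 'a vec set" where
  "eigenspace A k = mat_kernel (char_matrix A k)"

lemma eigenspace_iff:
  assumes "A \<in> carrier_mat n n"
  shows "v \<in> eigenspace A k \<longleftrightarrow> v = 0\<^sub>v n \<or> eigenvector A v k"
proof -
  have C: "char_matrix A k \<in> carrier_mat n n"
    using assms by simp
  have "char_matrix A k *\<^sub>v 0\<^sub>v n = 0\<^sub>v n"
    by (rule eq_vecI) (use C in auto)
  then show ?thesis
    unfolding eigenspace_def mat_kernel[OF C] eigenvector_char_matrix[OF assms]
    by (cases "v = 0\<^sub>v n") simp_all
qed

text \<open>
  Multiplicity is the dimension of the eigenspace; for the real symmetric matrices considered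
  here it agrees with the multiplicity as a root of the characteristic polynomial.
\<close>

definition eigen_mult :: "'a :: field mat \<Rightarrow> 'a \<Rightarrow> nat" where
  "eigen_mult A k = kernel_dim (char_matrix A k)"

text \<open>
  Indices start at 1. The value at 0 is a dummy, chosen such that the recurrence also yields
  the polynomial with index 2.
\<close>

fun path_poly :: "nat \<Rightarrow> real poly" where
  "path_poly 0 = 1"
| "path_poly (Suc 0) = 1"
| "path_poly (Suc (Suc r)) = [:2, - 1:] * path_poly (Suc r) - path_poly r"

lemma path_poly_simps:
  "path_poly 1 = 1"
  "path_poly 2 = [:1, - 1:]"
  "3 \<le> r \<Longrightarrow> path_poly r = [:2, - 1:] * path_poly (r - 1) - path_poly (r - 2)"
proof -
  show "path_poly 1 = 1" "path_poly 2 = [:1, - 1:]"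
    by (simp_all add: numeral_2_eq_2 one_pCons)
  assume "3 \<le> r"
  then obtain q where "r = Suc (Suc q)"
    by (metis add_Suc le_Suc_ex numeral_3_eq_3)
  then show "path_poly r = [:2, - 1:] * path_poly (r - 1) - path_poly (r - 2)"
    by simp
qed

lemma degree_path_poly: "degree (path_poly (Suc r)) = r"
proof -
  have "degree (path_poly (Suc r)) = r \<and> degree (path_poly (Suc (Suc r))) = Suc r"
  proof (induction r)
    case 0
    show ?case by (simp add: one_pCons)
  next
    case (Suc r)
    then have "path_poly (Suc (Suc r)) \<noteq> 0" by auto
    then have "degree ([:2, - 1:] * path_poly (Suc (Suc r))) = Suc (Suc r)"
      using Suc by (subst degree_mult_eq) auto
    then have "degree ([:2, - 1:] * path_poly (Suc (Suc r)) + - path_poly (Suc r)) = Suc (Suc r)"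
      using Suc by (subst degree_add_eq_left) auto
    then show ?case
      using Suc by (simp only: path_poly.simps(3)[of "Suc r"] diff_conv_add_uminus)
  qed
  then show ?thesis ..
qed

end

theory Submission
  imports Defs
begin

text \<open>
  At a node of a path, the eigenvalue equation determines the next entry of the vector from the
  two previous ones by the recurrence of the polynomials \<open>p\<^sub>r\<close>; hence every eigenvector to the
  eigenvalue s is a multiple of \<open>(p\<^sub>1(s), \<dots>, p\<^sub>n(s))\<close>. Tensor products of path eigenvectors are
  eigenvectors of the grid, so the two decompositions of \<open>\<lambda>\<close> give two independent vectors, which
  span the two-dimensional eigenspace. A nontrivial combination of them vanishes at two given
  nodes if and only if the 2 by 2 determinant of their entries there is zero.
\<close>

section \<open>Kernels of dimension two\<close>

text \<open>Multiplication by an invertible matrix keeps the kernel, and the Gauss-Jordan form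
  exhibits a finite basis of it. Finite dimension is what allows an independent set of the right
  size to be recognised as a basis.\<close>

lemma (in kernel) fin_dim: "Ker.fin_dim"
proof -
  let ?B = "gauss_jordan_single A"
  from gauss_jordan_single[OF A refl] obtain P Q where AB: "?B = P * A" "Q * P = 1\<^sub>m nr"
    "P \<in> carrier_mat nr nr" "Q \<in> carrier_mat nr nr"
    and B: "?B \<in> carrier_mat nr nc" and row: "row_echelon_form ?B"
    by auto
  have ker: "mat_kernel ?B = mat_kernel A"
    using mat_kernel_mult_eq[OF A AB(3,4,2)] AB(1) by simp
  interpret B: kernel nr nc ?B
    by unfold_locales (rule B)
  have "B.basis (set (find_base_vectors ?B))"
    by (rule find_base_vectors(3)[OF row B])
  then show ?thesis
    unfolding ker Ker.basis_def Ker.fin_dim_def by auto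
qed

text \<open>An independent pair in a two-dimensional kernel is a basis. Independence and conclusion
  are phrased entrywise so that they match functions on the nodes of a graph.\<close>

lemma mat_kernel_span_pair:
  assumes A: "A \<in> carrier_mat nr nc" and dim: "kernel_dim A = 2"
    and u: "u \<in> mat_kernel A" and w: "w \<in> mat_kernel A"
    and indep: "\<And>a b. (\<And>i. i < nc \<Longrightarrow> a * u $ i + b * w $ i = 0) \<Longrightarrow> a = 0 \<and> b = 0"
    and v: "v \<in> mat_kernel A"
  obtains a b where "\<And>i. i < nc \<Longrightarrow> v $ i = a * u $ i + b * w $ i"
proof -
  interpret kernel nr nc A
    by unfold_locales (rule A)
  \<comment> \<open>If \<open>u\<close> and \<open>w\<close> were equal, the coefficients 1 and -1
    would violate independence; \<open>{u, w}\<close> has two elements only for distinct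
    vectors.\<close>
  have neq: "u \<noteq> w"
    using indep[of 1 "-1"] by auto
  have comb: "lincomb c {u, w} $ i = c u * u $ i + c w * w $ i" if "i < nc" for c i
    using lincomb_index[OF that, of "{u, w}" c] u w neq by simp
  have "basis {u, w}"
  proof (rule Ker.dim_li_is_basis[OF fin_dim])
    show "\<not> lin_dep {u, w}"
    proof (rule Ker.finite_lin_indpt2)
      fix c
      assume "lincomb c {u, w} = 0\<^sub>v nc"
      then have "c u * u $ i + c w * w $ i = 0" if "i < nc" for i
        using comb[OF that, of c] that by simp
      then have "c u = 0 \<and> c w = 0" by (rule indep)
      then show "\<forall>x\<in>{u, w}. c x = 0" by simp
    qed (use u w in auto)
  qed (use u w dim neq in auto)
  then obtain c where "v = lincomb c {u, w}"
    using Ker.finite_in_span[of "{u, w}" v] u w v unfolding Ker.basis_def by auto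
  then show ?thesis
    using comb that[of "c u" "c w"] by blast
qed

section \<open>The Laplacian as an operator on functions\<close>

text \<open>This is \<open>D - A\<close> acting on functions on the nodes, free of any enumeration:
  the degree is absorbed by taking one term \<open>f u\<close> per neighbour.\<close>

definition laplace_op :: "'a pair_pre_digraph \<Rightarrow> ('a \<Rightarrow> real) \<Rightarrow> 'a \<Rightarrow> real" where
  "laplace_op G f u = (\<Sum>w | (u, w) \<in> parcs G. f u - f w)"

lemma laplace_op_mult_left: "laplace_op G (\<lambda>u. c * f u) x = c * laplace_op G f x"
  by (simp add: laplace_op_def sum_distrib_left right_diff_distrib)

lemma laplace_op_mult_right: "laplace_op G (\<lambda>u. f u * c) x = laplace_op G f x * c"
  by (simp add: laplace_op_def sum_distrib_right left_diff_distrib)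

lemma laplace_op_add: "laplace_op G (\<lambda>u. f u + g u) x = laplace_op G f x + laplace_op G g x"
  by (simp add: laplace_op_def add_diff_add sum.distrib)

lemma laplace_op_cong:
  assumes "pair_graph G" and "u \<in> pverts G" and "\<And>w. w \<in> pverts G \<Longrightarrow> f w = g w"
  shows "laplace_op G f u = laplace_op G g u"
proof -
  interpret pair_graph G by fact
  show ?thesis
    unfolding laplace_op_def using assms(2,3) in_arcsD2 by (intro sum.cong) auto
qed

text \<open>The enumeration \<open>vs\<close> is a bijection onto the nodes, so the sum over columns
  turns into a sum over the neighbours of \<open>vs ! i\<close>.\<close>

lemma laplacian_mat_mult_vec:
  assumes G: "pair_graph G" and vs: "distinct vs" "set vs = pverts G" and i: "i < length vs"
  shows "(laplacian_mat G vs *\<^sub>v vec (length vs) (\<lambda>k. f (vs ! k))) $ i = laplace_op G f (vs ! i)"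
proof -
  interpret pair_graph G by fact
  define N where "N = {w. (vs ! i, w) \<in> parcs G}"
  have N: "N \<subseteq> pverts G"
    using in_arcsD2 by (auto simp: N_def)
  have "out_arcs (with_proj G) (vs ! i) = Pair (vs ! i) ` N"
    by (auto simp: out_arcs_def N_def)
  then have deg: "out_degree (with_proj G) (vs ! i) = card N"
    by (simp add: out_degree_def card_image inj_on_def)
  have "(laplacian_mat G vs *\<^sub>v vec (length vs) (\<lambda>k. f (vs ! k))) $ i =
    (\<Sum>j<length vs. (if i = j then real (card N) else 0) * f (vs ! j)
      - (if vs ! j \<in> N then f (vs ! j) else 0))"
    using i by (auto simp: laplacian_mat_def degree_mat_def adjacency_mat_def scalar_prod_def
      deg N_def lessThan_atLeast0 left_diff_distrib intro!: sum.cong)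
  also have "\<dots> = (\<Sum>j<length vs. (if i = j then real (card N) * f (vs ! j) else 0))
      - (\<Sum>j<length vs. if vs ! j \<in> N then f (vs ! j) else 0)"
    by (simp add: sum_subtractf if_distrib[of "\<lambda>x. x * _"] cong: if_cong)
  also have "(\<Sum>j<length vs. if vs ! j \<in> N then f (vs ! j) else 0)
      = (\<Sum>w\<in>pverts G. if w \<in> N then f w else 0)"
    by (rule sum.reindex_bij_betw) (use bij_betw_nth[OF vs(1) refl vs(2)[symmetric]] in simp)
  also have "\<dots> = (\<Sum>w\<in>N. f w)"
    using N by (simp add: sum.If_cases pair_finite_verts Int_absorb1)
  finally show ?thesis
    using i by (simp add: laplace_op_def N_def sum_subtractf)
qed

lemma eigenvector_laplacian_mat_iff:
  assumes "pair_graph G" and vs: "distinct vs" "set vs = pverts G"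
  shows "eigenvector (laplacian_mat G vs) (vec (length vs) (\<lambda>k. f (vs ! k))) c \<longleftrightarrow>
    (\<exists>u\<in>pverts G. f u \<noteq> 0) \<and> (\<forall>u\<in>pverts G. laplace_op G f u = c * f u)"
proof -
  have dim: "dim_row (laplacian_mat G vs) = length vs"
    by (simp add: laplacian_mat_def degree_mat_def adjacency_mat_def)
  have "vec (length vs) (\<lambda>k. f (vs ! k)) \<noteq> 0\<^sub>v (length vs) \<longleftrightarrow> (\<exists>u\<in>pverts G. f u \<noteq> 0)"
    unfolding vec_eq_iff vs(2)[symmetric]
    by (auto simp: in_set_conv_nth intro: bexI[OF _ nth_mem])
  moreover have "laplacian_mat G vs *\<^sub>v vec (length vs) (\<lambda>k. f (vs ! k)) =
      c \<cdot>\<^sub>v vec (length vs) (\<lambda>k. f (vs ! k)) \<longleftrightarrow>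
    (\<forall>u\<in>pverts G. laplace_op G f u = c * f u)"
    unfolding vec_eq_iff vs(2)[symmetric]
    using dim laplacian_mat_mult_vec[OF assms, of _ f]
    by (auto simp: all_set_conv_all_nth simp del: index_mult_mat_vec)
  ultimately show ?thesis
    by (simp add: eigenvector_def dim)
qed

text \<open>Each arc of the product changes exactly one coordinate, so the neighbours of
  \<open>(u, x)\<close> fall into two classes, one for each factor.\<close>

lemma laplace_op_cart_prod:
  assumes "pair_graph G" and "pair_graph H" and "u \<in> pverts G" and "x \<in> pverts H"
  shows "laplace_op (cart_prod G H) f (u, x) =
    laplace_op G (\<lambda>v. f (v, x)) u + laplace_op H (\<lambda>y. f (u, y)) x"
proof -
  interpret G: pair_graph G by fact
  interpret H: pair_graph H by fact
  define M where "M = {v. (u, v) \<in> parcs G}"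
  define N where "N = {y. (x, y) \<in> parcs H}"
  have fin: "finite M" "finite N"
    by (rule finite_subset[OF _ G.pair_finite_verts] finite_subset[OF _ H.pair_finite_verts],
      auto simp: M_def N_def dest: G.in_arcsD2 H.in_arcsD2)+
  \<comment> \<open>A common element would be \<open>(u, x)\<close> itself, which requires a loop at
    \<open>u\<close>.\<close>
  have disj: "(\<lambda>v. (v, x)) ` M \<inter> Pair u ` N = {}"
    using G.pair_no_loops[of "(u, u)"] by (auto simp: M_def)
  have "{w. ((u, x), w) \<in> parcs (cart_prod G H)} = (\<lambda>v. (v, x)) ` M \<union> Pair u ` N"
    using assms(3,4) by (auto simp: cart_prod_def M_def N_def)
  then show ?thesis
    unfolding laplace_op_def M_def[symmetric] N_def[symmetric]
    using fin disj by (simp add: sum.union_disjoint sum.reindex inj_on_def)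
qed

text \<open>Separation of variables: along each direction the other factor is a constant, so the
  eigenvalues add.\<close>

lemma laplace_op_cart_prod_eigen:
  assumes "pair_graph G" and "pair_graph H" and "u \<in> pverts G" and "x \<in> pverts H"
    and "laplace_op G f u = a * f u" and "laplace_op H g x = b * g x"
  shows "laplace_op (cart_prod G H) (\<lambda>(v, y). f v * g y) (u, x) = (a + b) * (f u * g x)"
  using assms
  by (simp add: laplace_op_cart_prod laplace_op_mult_left laplace_op_mult_right algebra_simps)

section \<open>Eigenfunctions of the path\<close>

lemma laplace_op_path_graph:
  assumes "i \<in> {1..n}"
  shows "laplace_op (path_graph n) f i =
    (if 1 < i then f i - f (i - 1) else 0) + (if i < n then f i - f (i + 1) else 0)"
proof -
  have "{w. (i, w) \<in> parcs (path_graph n)} =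
      (if 1 < i then {i - 1} else {}) \<union> (if i < n then {i + 1} else {})"
    using assms by (auto simp: path_graph_def)
  then show ?thesis
    by (simp add: laplace_op_def)
qed

lemma path_eigenfunction_eq:
  assumes "\<And>i. i \<in> {1..n} \<Longrightarrow> laplace_op (path_graph n) f i = c * f i"
  shows "1 \<le> i \<Longrightarrow> i \<le> n \<Longrightarrow> f i = f 1 * poly (path_poly i) c"
proof (induction i rule: path_poly.induct)
  case (3 r)
  have "laplace_op (path_graph n) f (Suc r) = c * f (Suc r)"
    using assms 3 by simp
  \<comment> \<open>The equation at \<open>Suc r\<close> yields the entry at
    \<open>Suc (Suc r)\<close>. For \<open>r = 0\<close> there is no left neighbour, and the dummy
    value \<open>path_poly 0 = 1\<close> makes the recurrence produce the matching factor
    \<open>1 - c\<close>.\<close>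
  then show ?case
    using 3 by (cases "r = 0") (simp_all add: laplace_op_path_graph algebra_simps)
qed auto

text \<open>The recurrence alone gives the equations at the nodes before \<open>n\<close>; the one
  at \<open>n\<close> depends on \<open>c\<close> being an eigenvalue. All are transferred from an
  existing eigenvector, which is \<open>f 1\<close> times these values with \<open>f 1\<close>
  nonzero.\<close>

lemma laplace_op_path_poly:
  assumes "eigenvalue (path_laplacian n) c" and i: "i \<in> {1..n}"
  shows "laplace_op (path_graph n) (\<lambda>j. poly (path_poly j) c) i = c * poly (path_poly i) c"
proof -
  obtain v where v: "eigenvector (path_laplacian n) v c"
    using assms(1) by (auto simp: eigenvalue_def)
  define f where "f j = v $ (j - 1)" for j
  have "v = vec (length (path_nodes n)) (\<lambda>k. f (path_nodes n ! k))"
    using v by (intro eq_vecI)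
      (auto simp: eigenvector_def path_laplacian_def laplacian_mat_def adjacency_mat_def
        length_path_nodes f_def path_nodes_def simp del: upt_Suc)
  then have f: "\<exists>j\<in>{1..n}. f j \<noteq> 0"
      "\<And>j. j \<in> {1..n} \<Longrightarrow> laplace_op (path_graph n) f j = c * f j"
    using v eigenvector_laplacian_mat_iff[OF pair_graph_path_graph path_nodes, of n f c]
    by (auto simp: path_laplacian_def path_graph_def)
  have eq: "f j = f 1 * poly (path_poly j) c" if "j \<in> {1..n}" for j
    using path_eigenfunction_eq[OF f(2), of j] that by simp
  have "f 1 \<noteq> 0"
    using f(1) eq by (metis mult_zero_left)
  moreover have "f 1 * laplace_op (path_graph n) (\<lambda>j. poly (path_poly j) c) i =
      laplace_op (path_graph n) f i"
    unfolding laplace_op_mult_left[symmetric]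
    by (rule laplace_op_cong[OF pair_graph_path_graph])
      (use i eq[symmetric] in \<open>simp_all add: path_graph_def\<close>)
  then have "f 1 * laplace_op (path_graph n) (\<lambda>j. poly (path_poly j) c) i =
      f 1 * (c * poly (path_poly i) c)"
    unfolding f(2)[OF i] eq[OF i] by (simp add: ac_simps)
  ultimately show ?thesis by simp
qed

lemma path_poly_pair_independent:
  assumes "eigenvalue (path_laplacian n) c" and "eigenvalue (path_laplacian n) d" and "c \<noteq> d"
    and "1 \<le> n"
    and zero: "\<And>i. i \<in> {1..n} \<Longrightarrow> a * poly (path_poly i) c + b * poly (path_poly i) d = 0"
  shows "a = 0 \<and> b = 0"
proof -
  \<comment> \<open>The eigenvalue equations at node 1 express c and d by the entries at nodes 1 and 2, so the
    hypothesis at these two nodes gives a + b = 0 and a c + b d = 0.\<close>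
  have sum: "a + b = 0"
    using zero[of 1] assms(4) by simp
  have c: "c = (if 1 < n then 1 - poly (path_poly 2) c else 0)"
    and d: "d = (if 1 < n then 1 - poly (path_poly 2) d else 0)"
    using laplace_op_path_poly[OF assms(1), of 1] laplace_op_path_poly[OF assms(2), of 1] assms(4)
    by (auto simp: laplace_op_path_graph numeral_2_eq_2 simp del: path_poly.simps(3))
  have "a * c + b * d = 0"
  proof (cases "1 < n")
    case True
    then have "a * c + b * d =
        a + b - (a * poly (path_poly 2) c + b * poly (path_poly 2) d)"
      by (subst c, subst d) (simp add: algebra_simps)
    then show ?thesis
      using zero[of 2] sum True by simp
  qed (use c d in simp)
  moreover have "b = - a"
    using sum by simp
  ultimately have "a * (c - d) = 0"
    by (simp add: algebra_simps)
  then show ?thesis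
    using assms(3) sum by simp
qed

section \<open>Zeros of grid eigenvectors at two nodes\<close>

lemma ex_nontrivial_solution_pair_iff:
  fixes x y z w :: "'a :: field"
  shows "(\<exists>a b. (a \<noteq> 0 \<or> b \<noteq> 0) \<and> a * x + b * y = 0 \<and> a * z + b * w = 0) \<longleftrightarrow> x * w = y * z"
proof
  assume "\<exists>a b. (a \<noteq> 0 \<or> b \<noteq> 0) \<and> a * x + b * y = 0 \<and> a * z + b * w = 0"
  then obtain a b where ab: "a \<noteq> 0 \<or> b \<noteq> 0" "a * x + b * y = 0" "a * z + b * w = 0"
    by blast
  \<comment> \<open>The system is multiplied by the adjugate matrix, so the determinant annihilates
    both coefficients.\<close>
  have "a * (x * w - y * z) = (a * x + b * y) * w - (a * z + b * w) * y"
    "b * (x * w - y * z) = (a * z + b * w) * x - (a * x + b * y) * z"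
    by (simp_all add: algebra_simps)
  then show "x * w = y * z"
    using ab by auto
next
  assume det: "x * w = y * z"
  show "\<exists>a b. (a \<noteq> 0 \<or> b \<noteq> 0) \<and> a * x + b * y = 0 \<and> a * z + b * w = 0"
  proof (cases "x = 0 \<and> y = 0")
    case True
    have "\<exists>a b. (a \<noteq> 0 \<or> b \<noteq> 0) \<and> a * z + b * w = 0"
    proof (cases "w = 0")
      case True
      then show ?thesis
        by (intro exI[of _ 0] exI[of _ 1]) simp
    next
      case False
      then show ?thesis
        by (intro exI[of _ w] exI[of _ "- z"]) simp
    qed
    with True show ?thesis by simp
  next
    case False
    \<comment> \<open>The pair \<open>(y, -x)\<close> is nonzero and solves the first equation
      identically; the second one reduces to \<open>det\<close>.\<close>
    then show ?thesis
      using det by (intro exI[of _ y] exI[of _ "- x"]) (auto simp: algebra_simps)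
  qed
qed

theorem theoremV3:
  fixes n1 n2 nu1 nu2 l1 l2 :: nat
    and lam lam11 lam12 lam21 lam22 :: real
  assumes "eigenvalue (grid_laplacian n1 n2) lam"
    and "eigen_mult (grid_laplacian n1 n2) lam = 2"
    and "lam = lam11 + lam12"
    and "lam = lam21 + lam22"
    and "eigenvalue (path_laplacian n1) lam11"
    and "eigenvalue (path_laplacian n1) lam21"
    and "eigenvalue (path_laplacian n2) lam12"
    and "eigenvalue (path_laplacian n2) lam22"
    and "(lam11, lam12) \<noteq> (lam21, lam22)"
    and "nu1 \<in> {1..n1}" and "nu2 \<in> {1..n1}"
    and "l1 \<in> {1..n2}" and "l2 \<in> {1..n2}"
  shows "(\<exists>v \<in> eigenspace (grid_laplacian n1 n2) lam.
            eigenvector (grid_laplacian n1 n2) v lam \<and>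
            v $ grid_index n2 nu1 l1 = 0 \<and> v $ grid_index n2 nu2 l2 = 0) \<longleftrightarrow>
         poly (path_poly nu1) lam11 * poly (path_poly l1) lam12 *
           poly (path_poly nu2) lam21 * poly (path_poly l2) lam22 =
         poly (path_poly nu1) lam21 * poly (path_poly l1) lam22 *
           poly (path_poly nu2) lam11 * poly (path_poly l2) lam12"
proof -
  let ?G = "cart_prod (path_graph n1) (path_graph n2)"
  let ?A = "grid_laplacian n1 n2"
  define vs where "vs = List.product (path_nodes n1) (path_nodes n2)"
  define p where "p c i = poly (path_poly i) c" for c i
  define f where "f = (\<lambda>(i, j). p lam11 i * p lam12 j)"
  define g where "g = (\<lambda>(i, j). p lam21 i * p lam22 j)"
  define V where "V h = vec (length vs) (\<lambda>k. h (vs ! k))" for h :: "nat \<times> nat \<Rightarrow> real"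
  have vs: "distinct vs" "set vs = pverts ?G"
    unfolding vs_def by (rule grid_nodes)+
  have verts: "pverts ?G = {1..n1} \<times> {1..n2}"
    by (simp add: cart_prod_def path_graph_def)
  have len: "length vs = n1 * n2"
    by (simp add: vs_def length_path_nodes)
  have A: "?A \<in> carrier_mat (n1 * n2) (n1 * n2)"
    by (rule carrier_matI) (simp_all add: grid_laplacian_def laplacian_mat_def adjacency_mat_def
      length_path_nodes)
  have V_index: "V h $ grid_index n2 i j = h (i, j)" if "(i, j) \<in> pverts ?G" for h i j
    using grid_index[of i n1 j n2] that verts len by (simp add: V_def vs_def)
  have eigen_V: "eigenvector ?A (V h) lam \<longleftrightarrow>
      (\<exists>u\<in>pverts ?G. h u \<noteq> 0) \<and> (\<forall>u\<in>pverts ?G. laplace_op ?G h u = lam * h u)" for h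
    unfolding grid_laplacian_def V_def vs_def
    by (intro eigenvector_laplacian_mat_iff grid_nodes pair_graph_cart_prod pair_graph_path_graph)
  \<comment> \<open>The grid is nonempty because \<open>nu1\<close> and \<open>l1\<close> lie in
    their ranges. At \<open>(1, 1)\<close> both \<open>f\<close> and \<open>g\<close> take the value
    1, since the first polynomial is 1.\<close>
  have ones: "(1, 1) \<in> pverts ?G"
    using assms(10,12) verts by auto
  have "laplace_op ?G f u = lam * f u \<and> laplace_op ?G g u = lam * g u"
    if u_mem: "u \<in> pverts ?G" for u
  proof -
    obtain i j where u: "u = (i, j)" "i \<in> {1..n1}" "j \<in> {1..n2}"
      using u_mem unfolding verts by blast
    then have "i \<in> pverts (path_graph n1)" "j \<in> pverts (path_graph n2)"
      by (simp_all add: path_graph_def)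
    note eigen = laplace_op_cart_prod_eigen[OF pair_graph_path_graph pair_graph_path_graph this]
    show ?thesis
      unfolding f_def g_def p_def u(1) prod.case
      using eigen[OF laplace_op_path_poly[OF assms(5) u(2)] laplace_op_path_poly[OF assms(7) u(3)]]
        eigen[OF laplace_op_path_poly[OF assms(6) u(2)] laplace_op_path_poly[OF assms(8) u(3)]]
      unfolding assms(3)[symmetric] assms(4)[symmetric] by (rule conjI)
  qed
  moreover have "f (1, 1) \<noteq> 0" "g (1, 1) \<noteq> 0"
    by (simp_all add: f_def g_def p_def)
  ultimately have eig: "eigenvector ?A (V f) lam" "eigenvector ?A (V g) lam"
    unfolding eigen_V using ones by blast+
  \<comment> \<open>Both sums equal \<open>lam\<close>, so equal first summands would force equal
    second ones.\<close>
  have neq: "lam11 \<noteq> lam21"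
    using assms(3,4,9) by auto
  have indep: "a = 0 \<and> b = 0"
    if zero: "\<And>u. u \<in> pverts ?G \<Longrightarrow> a * f u + b * g u = 0" for a b
  proof (rule path_poly_pair_independent[OF assms(5,6) neq])
    show "1 \<le> n1"
      using assms(10) by simp
    \<comment> \<open>On the nodes with second coordinate 1 the second factors are 1, which leaves a
      relation between two eigenfunctions of the first path.\<close>
    show "a * poly (path_poly i) lam11 + b * poly (path_poly i) lam21 = 0" if "i \<in> {1..n1}" for i
      using zero[of "(i, 1)"] that ones verts
      by (simp add: f_def g_def p_def)
  qed
  let ?S = "\<lambda>a b. (a \<noteq> 0 \<or> b \<noteq> 0) \<and>
    a * f (nu1, l1) + b * g (nu1, l1) = 0 \<and> a * f (nu2, l2) + b * g (nu2, l2) = 0"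
  have nodes: "(nu1, l1) \<in> pverts ?G" "(nu2, l2) \<in> pverts ?G"
    using assms(10-13) verts by auto
  have "(\<exists>v\<in>eigenspace ?A lam. eigenvector ?A v lam \<and>
      v $ grid_index n2 nu1 l1 = 0 \<and> v $ grid_index n2 nu2 l2 = 0) \<longleftrightarrow> (\<exists>a b. ?S a b)"
  proof
    assume "\<exists>v\<in>eigenspace ?A lam. eigenvector ?A v lam \<and>
      v $ grid_index n2 nu1 l1 = 0 \<and> v $ grid_index n2 nu2 l2 = 0"
    then obtain v where v: "eigenvector ?A v lam" "v \<in> eigenspace ?A lam"
      and v0: "v $ grid_index n2 nu1 l1 = 0" "v $ grid_index n2 nu2 l2 = 0"
      by blast
    have C: "char_matrix ?A lam \<in> carrier_mat (n1 * n2) (n1 * n2)"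
      using A by simp
    \<comment> \<open>Multiplicity two enters here: it puts the arbitrary \<open>v\<close> into the
      span of \<open>V f\<close> and \<open>V g\<close>.\<close>
    obtain a b where ab: "\<And>k. k < n1 * n2 \<Longrightarrow> v $ k = a * V f $ k + b * V g $ k"
    proof (rule mat_kernel_span_pair[OF C])
      show "kernel_dim (char_matrix ?A lam) = 2"
        using assms(2) by (simp add: eigen_mult_def)
      show "V f \<in> mat_kernel (char_matrix ?A lam)" "V g \<in> mat_kernel (char_matrix ?A lam)"
        "v \<in> mat_kernel (char_matrix ?A lam)"
        using eig v eigenspace_iff[OF A] by (simp_all add: eigenspace_def)
      show "a = 0 \<and> b = 0" if *: "\<And>k. k < n1 * n2 \<Longrightarrow> a * V f $ k + b * V g $ k = 0" for a b
      proof (rule indep)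
        fix u assume "u \<in> pverts ?G"
        then obtain k where "k < n1 * n2" "u = vs ! k"
          using vs(2) len by (metis in_set_conv_nth)
        then show "a * f u + b * g u = 0"
          using *[of k] len by (simp add: V_def)
      qed
    qed (use that in blast)
    have "a \<noteq> 0 \<or> b \<noteq> 0"
    proof (rule ccontr)
      assume "\<not> ?thesis"
      then have "v = 0\<^sub>v (n1 * n2)"
        using ab v(1) A by (intro eq_vecI) (auto simp: eigenvector_def)
      then show False
        using v(1) A by (simp add: eigenvector_def)
    qed
    moreover have "a * f (i, j) + b * g (i, j) = v $ grid_index n2 i j"
      if "(i, j) \<in> pverts ?G" for i j
      using ab[of "grid_index n2 i j"] grid_index(1)[of i n1 j n2] that verts
      by (simp add: V_index)
    ultimately show "\<exists>a b. ?S a b"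
      using v0 nodes by metis
  next
    assume "\<exists>a b. ?S a b"
    then obtain a b where ab: "?S a b" by blast
    define h where "h u = a * f u + b * g u" for u
    have "\<exists>u\<in>pverts ?G. h u \<noteq> 0"
      using indep[of a b] ab by (auto simp: h_def)
    moreover have "laplace_op ?G h u = lam * h u" if "u \<in> pverts ?G" for u
      using eig that
      by (simp add: eigen_V h_def[abs_def] laplace_op_add laplace_op_mult_left algebra_simps)
    ultimately have "eigenvector ?A (V h) lam"
      by (simp add: eigen_V)
    moreover have "V h $ grid_index n2 nu1 l1 = 0" "V h $ grid_index n2 nu2 l2 = 0"
      using ab by (simp_all add: V_index nodes h_def)
    ultimately show "\<exists>v\<in>eigenspace ?A lam. eigenvector ?A v lam \<and>
        v $ grid_index n2 nu1 l1 = 0 \<and> v $ grid_index n2 nu2 l2 = 0"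
      using eigenspace_iff[OF A] by blast
  qed
  also have "\<dots> \<longleftrightarrow> f (nu1, l1) * g (nu2, l2) = g (nu1, l1) * f (nu2, l2)"
    by (rule ex_nontrivial_solution_pair_iff)
  finally show ?thesis
    by (simp add: f_def g_def p_def mult.assoc)
qed

end
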